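(* Let $N=2^n$ with $n\ge1$, and let $B(\boldsymbol\theta)$ be a scalar or diagonal (simple or nonsimple) butterfly matrix of order $N$ with input angle vector $\boldsymbol\theta=(\theta_j)_{j=1}^M$ such that $\theta_j\notin\frac{\pi}{2}\mathbb Z$ for all $j$. Let $\hat{\boldsymbol\theta}=(\hat\theta_j)_{j=1}^M$ with $\hat\theta_j=\frac{\pi}{4}\left(2\left\lfloor\frac{2\theta_j}{\pi}\right\rfloor+1\right)$. Then $\operatorname{sgn}(B(\boldsymbol\theta))=\sqrt N\cdot B(\hat{\boldsymbol\theta})$, and this matrix is a Hadamard matrix.
   Context: Butterfly matrices of order $N=2^n$ are defined recursively: the order $1$ butterfly matrix is $1$, and an order $N$ one has the form $$B=\begin{bmatrix}C&S\\-S&C\end{bmatrix}\begin{bmatrix}A_1&0\\0&A_2\end{bmatrix}=\begin{bmatrix}CA_1&SA_2\\-SA_1&CA_2\end{bmatrix}$$ with $A_1,A_2$ butterfly matrices of order $N/2$ of the same type. In the scalar type, $(C,S)=(\cos\theta\, I_{N/2},\sin\theta\, I_{N/2})$ for one angle $\theta$ at each occurrence of the recursion. In the diagonal type, $C=\operatorname{diag}(\cos\theta^{(1)},\dots,\cos\theta^{(N/2)})$ and $S=\operatorname{diag}(\sin\theta^{(1)},\dots,\sin\theta^{(N/2)})$ for $N/2$ angles. The matrix is simple if $A_1=A_2$ at each recursive step, and nonsimple in general ($A_1,A_2$ with their own independent angles). The vector $\boldsymbol\theta\in[0,2\pi)^M$ collects all the angles used, with $M=n$ (scalar simple), $N-1$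 (scalar nonsimple), $N-1$ (diagonal simple), $nN/2$ (diagonal nonsimple); $B(\boldsymbol\theta)$ denotes the resulting matrix and $B(\hat{\boldsymbol\theta})$ is the matrix of the same type built with each angle $\theta_j$ replaced by $\hat\theta_j$. The function $\operatorname{sgn}$ acts on matrices entrywise, $\operatorname{sgn}(x)=x/|x|$ for $x\neq0$ and $\operatorname{sgn}(0)=0$. A Hadamard matrix of order $N$ is $H\in\{\pm1\}^{N\times N}$ with $HH^\top=N I_N$. *)

theory Defs
  imports Complex_Main "Jordan_Normal_Form.Matrix"
begin

datatype angle_type = Scalar | Diagonal

datatype recursion_type = Simple | Nonsimple

text \<open>Number of angles used by the outermost rotation factor in order \<open>2 ^ Suc n\<close>.\<close>

fun step_angles :: "angle_type \<Rightarrow> nat \<Rightarrow> nat" where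
  "step_angles Scalar n = 1"
| "step_angles Diagonal n = 2 ^ n"

text \<open>Total number of angles \<open>M\<close> used in order \<open>N = 2 ^ n\<close>.\<close>

fun num_angles :: "angle_type \<Rightarrow> recursion_type \<Rightarrow> nat \<Rightarrow> nat" where
  "num_angles Scalar Simple n = n"
| "num_angles Scalar Nonsimple n = 2 ^ n - 1"
| "num_angles Diagonal Simple n = 2 ^ n - 1"
| "num_angles Diagonal Nonsimple n = n * 2 ^ n div 2"

text \<open>The diagonal block \<open>diag (f \<phi>\<^sub>1, f \<phi>\<^sub>2, \<dots>)\<close> of order \<open>2 ^ n\<close>, to be used with \<open>f = cos\<close>
  and \<open>f = sin\<close>; in the scalar case \<open>\<phi>\<close> has a single component.\<close>

fun rotation_block :: "angle_type \<Rightarrow> (real \<Rightarrow> real) \<Rightarrow> nat \<Rightarrow> real vec \<Rightarrow> real mat" where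
  "rotation_block Scalar f n \<phi> = f (\<phi> $ 0) \<cdot>\<^sub>m 1\<^sub>m (2 ^ n)"
| "rotation_block Diagonal f n \<phi> = mat_diag (2 ^ n) (\<lambda>i. f (\<phi> $ i))"

definition subvec :: "'a vec \<Rightarrow> nat \<Rightarrow> nat \<Rightarrow> 'a vec" where
  "subvec v k m = vec m (\<lambda>i. v $ (k + i))"

text \<open>\<open>butterfly a r n \<theta>\<close> is the butterfly matrix \<open>B(\<theta>)\<close> of order \<open>2 ^ n\<close>. The angle vector is laid out
  as the angles of the outermost factor, followed by those of \<open>A\<^sub>1\<close>, followed, in the nonsimple
  case only, by those of \<open>A\<^sub>2\<close>. It is meant for \<open>\<theta> \<in> carrier_vec (num_angles a r n)\<close>.\<close>

fun butterfly :: "angle_type \<Rightarrow> recursion_type \<Rightarrow> nat \<Rightarrow> real vec \<Rightarrow> real mat" where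
  "butterfly a r 0 \<theta> = 1\<^sub>m 1"
| "butterfly a r (Suc n) \<theta> =
    (let p = step_angles a n;
         m = num_angles a r n;
         \<phi> = subvec \<theta> 0 p;
         C = rotation_block a cos n \<phi>;
         S = rotation_block a sin n \<phi>;
         A\<^sub>1 = butterfly a r n (subvec \<theta> p m);
         A\<^sub>2 = (case r of Simple \<Rightarrow> A\<^sub>1 | Nonsimple \<Rightarrow> butterfly a r n (subvec \<theta> (p + m) m))
     in four_block_mat C S (- S) C *
        four_block_mat A\<^sub>1 (0\<^sub>m (2 ^ n) (2 ^ n)) (0\<^sub>m (2 ^ n) (2 ^ n)) A\<^sub>2)"

definition hadamard_mat :: "nat \<Rightarrow> real mat \<Rightarrow> bool" where
  "hadamard_mat N H \<longleftrightarrow>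
     H \<in> carrier_mat N N \<and>
     (\<forall>i<N. \<forall>j<N. H $$ (i, j) \<in> {1, - 1}) \<and>
     H * H\<^sup>T = real N \<cdot>\<^sub>m 1\<^sub>m N"

text \<open>The closed forms above agree with the recursive layout, so that every component of the angle
  vector is used.\<close>

lemma num_angles_0: "num_angles a r 0 = 0"
  by (cases a; cases r) auto

lemma num_angles_Suc_Simple:
  "num_angles a Simple (Suc n) = step_angles a n + num_angles a Simple n"
  by (cases a) simp_all

lemma num_angles_Suc_Nonsimple:
  "num_angles a Nonsimple (Suc n) = step_angles a n + 2 * num_angles a Nonsimple n"
proof (cases a)
  case Scalar
  obtain k :: nat where "2 ^ n = Suc k"
    by (metis not0_implies_Suc power_not_zero zero_neq_numeral)
  with Scalar show ?thesis by simp
next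
  case Diagonal
  have "Suc n * 2 ^ Suc n div 2 = Suc n * 2 ^ n"
    by simp
  moreover have "2 * (n * 2 ^ n div 2) = n * 2 ^ n"
    by (cases n) simp_all
  ultimately show ?thesis
    using Diagonal by (simp only: num_angles.simps step_angles.simps mult_Suc)
qed

end

theory Submission
  imports Defs
begin

text \<open>
  The outermost rotation of a butterfly matrix never adds two nonzero entries, since the inner factor
  is block diagonal. So every entry of \<open>B(\<theta>)\<close> of order \<open>2 ^ Suc n\<close> is
  a single product \<open>\<plusminus> cos t * b\<close> or \<open>\<plusminus> sin t * b\<close>, where \<open>t\<close> is one of the angles and \<open>b\<close> is an entry of
  a butterfly matrix of order \<open>2 ^ n\<close> (\<open>butterfly_Suc_index\<close>). Unrolling the recursion, an entry of
  \<open>B(\<theta>)\<close> is up to sign a product of \<open>n\<close> cosines and sines, with no sums, so it never vanishes when no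
  angle is a multiple of \<open>pi / 2\<close>, and \<open>sgn\<close> can be taken factor by factor.

  For a single factor, \<open>sgn (cos t)\<close> and \<open>sgn (sin t)\<close> only depend on the open quadrant of \<open>t\<close>. The angle
  \<open>t'\<close> that replaces \<open>t\<close> is the bisector of that quadrant, where cosine and sine both have absolute value
  \<open>1 / sqrt 2\<close>; hence \<open>sgn (cos t) = sqrt 2 * cos t'\<close> and likewise for the sine
  (\<open>sgn_cos_sin_eq_bisector\<close>). The \<open>n\<close> factors \<open>sqrt 2\<close> multiply to \<open>sqrt N\<close> (\<open>sgn_butterfly_index\<close>).

  Finally, butterfly matrices are orthogonal for all angles, being products of block rotations
  (\<open>butterfly_orthogonal\<close>). So \<open>H = sqrt N * B(\<theta>')\<close> satisfies \<open>H * H\<^sup>T = N * 1\<close>.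
\<close>

section \<open>Signs of cosine and sine\<close>

definition quadrant_bisector :: "real \<Rightarrow> real" where
  "quadrant_bisector t = pi / 4 * (2 * real_of_int \<lfloor>2 * t / pi\<rfloor> + 1)"

definition off_axes :: "real \<Rightarrow> bool" where
  "off_axes t \<longleftrightarrow> \<not> (\<exists>k::int. t = pi / 2 * real_of_int k)"

text \<open>Rotating by \<open>x = k * pi / 2\<close> reduces everything to the first quadrant: \<open>t = x + d\<close> with
  \<open>0 < d < pi / 2\<close> and the bisector is \<open>x + pi / 4\<close>. Since one of \<open>cos x\<close>, \<open>sin x\<close> is zero and the other
  is a sign, no cancellation occurs in the addition theorems.\<close>

lemma sgn_cos_sin_eq_bisector:
  assumes "off_axes t"
  shows "sgn (cos t) = sqrt 2 * cos (quadrant_bisector t)"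
    and "sgn (sin t) = sqrt 2 * sin (quadrant_bisector t)"
proof -
  define k where "k = \<lfloor>2 * t / pi\<rfloor>"
  define x where "x = real_of_int k * pi / 2"
  define d where "d = t - x"
  have "real_of_int k \<le> 2 * t / pi" "2 * t / pi < real_of_int k + 1"
    unfolding k_def by linarith+
  then have "0 \<le> d" "d < pi / 2"
    by (simp_all add: d_def x_def field_simps)
  moreover have "d \<noteq> 0"
    using assms by (auto simp: off_axes_def d_def x_def mult.commute)
  ultimately have d: "cos d > 0" "sin d > 0"
    by (simp_all add: cos_gt_zero sin_gt_zero2)
  have "2 * sin x * cos x = sin (real_of_int k * pi)"
    by (simp add: sin_double[symmetric] x_def)
  then have "sin x = 0 \<or> cos x = 0"
    using sin_npi_int[of k] by (auto simp: mult.commute)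
  moreover have "s = 0 \<and> (c = 1 \<or> c = - 1) \<or> c = 0 \<and> (s = 1 \<or> s = - 1)"
    if "s = 0 \<or> c = 0" "s\<^sup>2 + c\<^sup>2 = 1" for s c :: real
    using that by (auto simp: power2_eq_1_iff)
  ultimately have x: "sin x = 0 \<and> (cos x = 1 \<or> cos x = - 1) \<or> cos x = 0 \<and> (sin x = 1 \<or> sin x = - 1)"
    using sin_cos_squared_add[of x] by blast
  have t: "t = x + d" and b: "quadrant_bisector t = x + pi / 4"
    by (simp_all add: d_def x_def quadrant_bisector_def k_def algebra_simps)
  show "sgn (cos t) = sqrt 2 * cos (quadrant_bisector t)"
    unfolding b using x d by (auto simp: t cos_add cos_45 sin_45)
  show "sgn (sin t) = sqrt 2 * sin (quadrant_bisector t)"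
    unfolding b using x d by (auto simp: t sin_add cos_45 sin_45)
qed

section \<open>One step of the recursion, uniformly in the types\<close>

text \<open>The planar rotations in the outermost factor mix the rows \<open>i\<close> and \<open>2 ^ n + i\<close>; in the scalar type
  they all share the first angle.\<close>

definition row_angle :: "angle_type \<Rightarrow> real vec \<Rightarrow> nat \<Rightarrow> real" where
  "row_angle a \<theta> i = \<theta> $ (case a of Scalar \<Rightarrow> 0 | Diagonal \<Rightarrow> i)"

definition left_angles :: "angle_type \<Rightarrow> recursion_type \<Rightarrow> nat \<Rightarrow> real vec \<Rightarrow> real vec" where
  "left_angles a r n \<theta> = subvec \<theta> (step_angles a n) (num_angles a r n)"

definition right_angles :: "angle_type \<Rightarrow> recursion_type \<Rightarrow> nat \<Rightarrow> real vec \<Rightarrow> real vec" where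
  "right_angles a r n \<theta> =
    (case r of Simple \<Rightarrow> left_angles a r n \<theta>
     | Nonsimple \<Rightarrow> subvec \<theta> (step_angles a n + num_angles a r n) (num_angles a r n))"

text \<open>All angles used in one step are components of the whole vector, so a property of every component
  is inherited by them. Formulating this for a relation between two angle vectors serves both the
  comparison of \<open>\<theta>\<close> with its bisectors and, with the second vector ignored, properties of \<open>\<theta>\<close>.\<close>

lemma
  assumes R: "\<forall>j < num_angles a r (Suc n). R (\<theta> $ j) (\<theta>' $ j)"
  shows row_angle_inherits: "\<forall>i < 2 ^ n. R (row_angle a \<theta> i) (row_angle a \<theta>' i)"
    and left_angles_inherits: "\<forall>j < num_angles a r n.
      R (left_angles a r n \<theta> $ j) (left_angles a r n \<theta>' $ j)"
    and right_angles_inherits: "\<forall>j < num_angles a r n.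
      R (right_angles a r n \<theta> $ j) (right_angles a r n \<theta>' $ j)"
proof -
  have M: "num_angles a r (Suc n) \<ge> step_angles a n + num_angles a r n"
    "r = Nonsimple \<Longrightarrow> num_angles a r (Suc n) = step_angles a n + 2 * num_angles a r n"
    by (cases r; simp add: num_angles_Suc_Simple num_angles_Suc_Nonsimple del: num_angles.simps)+
  show "\<forall>i < 2 ^ n. R (row_angle a \<theta> i) (row_angle a \<theta>' i)"
    unfolding row_angle_def using R M(1)
    by (cases a) (simp_all del: num_angles.simps)
  show left: "\<forall>j < num_angles a r n. R (left_angles a r n \<theta> $ j) (left_angles a r n \<theta>' $ j)"
    unfolding left_angles_def subvec_def using R M(1)
    by (simp del: num_angles.simps)
  show "\<forall>j < num_angles a r n. R (right_angles a r n \<theta> $ j) (right_angles a r n \<theta>' $ j)"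
    unfolding right_angles_def using R M(2) left
    by (cases r) (simp_all del: num_angles.simps add: subvec_def)
qed

definition block_rotation :: "nat \<Rightarrow> (nat \<Rightarrow> real) \<Rightarrow> real mat" where
  "block_rotation m t =
    four_block_mat (mat_diag m (\<lambda>i. cos (t i))) (mat_diag m (\<lambda>i. sin (t i)))
      (- mat_diag m (\<lambda>i. sin (t i))) (mat_diag m (\<lambda>i. cos (t i)))"

definition block_diagonal :: "nat \<Rightarrow> real mat \<Rightarrow> real mat \<Rightarrow> real mat" where
  "block_diagonal m A B = four_block_mat A (0\<^sub>m m m) (0\<^sub>m m m) B"

lemma rotation_block_eq_mat_diag:
  "rotation_block a f n (subvec \<theta> 0 (step_angles a n)) = mat_diag (2 ^ n) (\<lambda>i. f (row_angle a \<theta> i))"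
  by (cases a; intro eq_matI) (auto simp: mat_diag_def row_angle_def subvec_def)

lemma butterfly_Suc_factors:
  "butterfly a r (Suc n) \<theta> =
    block_rotation (2 ^ n) (row_angle a \<theta>) *
    block_diagonal (2 ^ n) (butterfly a r n (left_angles a r n \<theta>))
      (butterfly a r n (right_angles a r n \<theta>))"
  by (cases r) (simp_all add: Let_def rotation_block_eq_mat_diag block_rotation_def
      block_diagonal_def left_angles_def right_angles_def del: num_angles.simps)

lemma block_rotation_carrier [simp]: "block_rotation m t \<in> carrier_mat (2 * m) (2 * m)"
  by (simp add: block_rotation_def mult_2)

lemma block_diagonal_carrier [simp]:
  "A \<in> carrier_mat m m \<Longrightarrow> B \<in> carrier_mat m m \<Longrightarrow>
    block_diagonal m A B \<in> carrier_mat (2 * m) (2 * m)"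
  by (simp add: block_diagonal_def mult_2)

lemma butterfly_carrier [simp]: "butterfly a r n \<theta> \<in> carrier_mat (2 ^ n) (2 ^ n)"
proof (induction n arbitrary: \<theta>)
  case (Suc n)
  then show ?case
    by (auto simp: butterfly_Suc_factors simp del: butterfly.simps
        intro!: mult_carrier_mat[OF block_rotation_carrier block_diagonal_carrier])
qed simp

section \<open>Orthogonality\<close>

text \<open>In the product with the transpose the diagonal blocks become \<open>cos\<^sup>2 + sin\<^sup>2\<close>, and the
  off-diagonal ones cancel because diagonal matrices commute.\<close>

lemma block_rotation_orthogonal: "block_rotation m t * (block_rotation m t)\<^sup>T = 1\<^sub>m (2 * m)"
proof -
  let ?C = "mat_diag m (\<lambda>i. cos (t i))" and ?S = "mat_diag m (\<lambda>i. sin (t i))"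
  have C: "?C \<in> carrier_mat m m" and S: "?S \<in> carrier_mat m m" and S': "- ?S \<in> carrier_mat m m"
    by simp_all
  have T: "(mat_diag m f)\<^sup>T = mat_diag m f" for f :: "nat \<Rightarrow> real"
    by (rule eq_matI) (auto simp: mat_diag_def)
  have T': "(- mat_diag m f)\<^sup>T = - mat_diag m f" for f :: "nat \<Rightarrow> real"
    by (rule eq_matI) (auto simp: mat_diag_def)
  have "?C * ?C + ?S * ?S = 1\<^sub>m m" "- ?S * - ?S + ?C * ?C = 1\<^sub>m m"
    "?C * - ?S + ?S * ?C = 0\<^sub>m m m" "- ?S * ?C + ?C * ?S = 0\<^sub>m m m"
    by (auto simp: mat_diag_def mat_diag_mult_left[of _ m m, unfolded mat_diag_def]
        power2_eq_square[symmetric] intro!: eq_matI)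
  then show ?thesis
    unfolding block_rotation_def transpose_four_block_mat[OF C S S' C] T T'
      mult_four_block_mat[OF C S S' C C S' S C]
    by (simp add: mult_2)
qed

lemma block_diagonal_orthogonal:
  assumes A: "A \<in> carrier_mat m m" and B: "B \<in> carrier_mat m m"
    and "A * A\<^sup>T = 1\<^sub>m m" "B * B\<^sup>T = 1\<^sub>m m"
  shows "block_diagonal m A B * (block_diagonal m A B)\<^sup>T = 1\<^sub>m (2 * m)"
proof -
  have Z: "0\<^sub>m m m \<in> carrier_mat m m" and A': "A\<^sup>T \<in> carrier_mat m m" and B': "B\<^sup>T \<in> carrier_mat m m"
    using A B by simp_all
  show ?thesis
    unfolding block_diagonal_def transpose_four_block_mat[OF A Z Z B] zero_transpose_mat
      mult_four_block_mat[OF A Z Z B A' Z Z B']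
    using assms by (simp add: mult_2)
qed

lemma mult_orthogonal:
  fixes Q P :: "real mat"
  assumes Q: "Q \<in> carrier_mat m m" and P: "P \<in> carrier_mat m m"
    and "Q * Q\<^sup>T = 1\<^sub>m m" "P * P\<^sup>T = 1\<^sub>m m"
  shows "(Q * P) * (Q * P)\<^sup>T = 1\<^sub>m m"
proof -
  have Q': "Q\<^sup>T \<in> carrier_mat m m" and P': "P\<^sup>T \<in> carrier_mat m m"
    using Q P by simp_all
  have "(Q * P) * (Q * P)\<^sup>T = Q * (P * (P\<^sup>T * Q\<^sup>T))"
    using transpose_mult[OF Q P] assoc_mult_mat[OF Q P] Q' P' by (metis mult_carrier_mat)
  also have "P * (P\<^sup>T * Q\<^sup>T) = Q\<^sup>T"
    using assoc_mult_mat[OF P P' Q'] assms Q' by (metis left_mult_one_mat)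
  finally show ?thesis
    using assms by simp
qed

lemma butterfly_orthogonal: "butterfly a r n \<theta> * (butterfly a r n \<theta>)\<^sup>T = 1\<^sub>m (2 ^ n)"
proof (induction n arbitrary: \<theta>)
  case (Suc n)
  show ?case
    unfolding butterfly_Suc_factors power_Suc
    by (intro mult_orthogonal block_rotation_orthogonal block_diagonal_orthogonal
        block_rotation_carrier block_diagonal_carrier butterfly_carrier Suc)
qed simp

section \<open>Entries as products\<close>

text \<open>Multiplying by a diagonal block from the left scales rows without mixing them, and the zero
  blocks remove the second summand of each block product; so no sums survive.\<close>

lemma block_rotation_mult_block_diagonal:
  assumes A: "A \<in> carrier_mat m m" and B: "B \<in> carrier_mat m m"
  shows "block_rotation m t * block_diagonal m A B =
    four_block_mat (mat m m (\<lambda>(i, j). cos (t i) * A $$ (i, j)))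
      (mat m m (\<lambda>(i, j). sin (t i) * B $$ (i, j)))
      (mat m m (\<lambda>(i, j). - sin (t i) * A $$ (i, j)))
      (mat m m (\<lambda>(i, j). cos (t i) * B $$ (i, j)))"
proof -
  let ?C = "mat_diag m (\<lambda>i. cos (t i))" and ?S = "mat_diag m (\<lambda>i. sin (t i))"
  have C: "?C \<in> carrier_mat m m" and S: "?S \<in> carrier_mat m m" and S': "- ?S \<in> carrier_mat m m"
    and Z: "0\<^sub>m m m \<in> carrier_mat m m"
    by simp_all
  have neg: "- ?S = mat_diag m (\<lambda>i. - sin (t i))"
    by (rule eq_matI) (auto simp: mat_diag_def)
  show ?thesis
    unfolding block_rotation_def block_diagonal_def mult_four_block_mat[OF C S S' C A Z Z B]
    unfolding neg mat_diag_mult_left[OF A] mat_diag_mult_left[OF B] mat_diag_mult_left[OF Z]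
    by (intro arg_cong4[where f = four_block_mat]) (auto intro!: eq_matI)
qed

lemma butterfly_Suc_index:
  assumes "i < 2 ^ Suc n" "j < 2 ^ Suc n"
  defines "i' \<equiv> if i < 2 ^ n then i else i - 2 ^ n" and "j' \<equiv> if j < 2 ^ n then j else j - 2 ^ n"
  shows "butterfly a r (Suc n) \<theta> $$ (i, j) =
    (let t = row_angle a \<theta> i'
     in if i < 2 ^ n then (if j < 2 ^ n then cos t else sin t)
        else (if j < 2 ^ n then - sin t else cos t)) *
    butterfly a r n ((if j < 2 ^ n then left_angles else right_angles) a r n \<theta>) $$ (i', j')"
  using assms(1,2)
  by (simp add: butterfly_Suc_factors block_rotation_mult_block_diagonal i'_def j'_def Let_def
      del: butterfly.simps num_angles.simps)

lemma off_axes_cos_sin_nonzero: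
  assumes "off_axes t"
  shows "cos t \<noteq> 0" "sin t \<noteq> 0"
proof -
  show "cos t \<noteq> 0"
  proof
    assume "cos t = 0"
    then obtain k :: int where "t = of_int k * (pi / 2)"
      unfolding cos_zero_iff_int by blast
    with assms show False
      by (auto simp: off_axes_def mult.commute)
  qed
  show "sin t \<noteq> 0"
  proof
    assume "sin t = 0"
    then obtain k :: int where "t = of_int k * (pi / 2)"
      unfolding sin_zero_iff_int by blast
    with assms show False
      by (auto simp: off_axes_def mult.commute)
  qed
qed

text \<open>A product of nonzero factors, by induction along the recursion. This is what makes the sign
  matrix a \<open>\<plusminus>1\<close> matrix.\<close>

lemma butterfly_index_nonzero:
  assumes "\<forall>j < num_angles a r n. off_axes (\<theta> $ j)" "i < 2 ^ n" "j < 2 ^ n"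
  shows "butterfly a r n \<theta> $$ (i, j) \<noteq> 0"
  using assms
proof (induction n arbitrary: \<theta> i j)
  case (Suc n)
  note inherits = row_angle_inherits left_angles_inherits right_angles_inherits
  note off = inherits[where R = "\<lambda>t _. off_axes t", OF Suc.prems(1)]
  define i' j' where "i' = (if i < 2 ^ n then i else i - 2 ^ n)"
    and "j' = (if j < 2 ^ n then j else j - 2 ^ n)"
  have less: "i' < 2 ^ n" "j' < 2 ^ n"
    using Suc.prems(2,3) by (auto simp: i'_def j'_def)
  show ?case
    unfolding butterfly_Suc_index[OF Suc.prems(2,3)] i'_def[symmetric] j'_def[symmetric]
    using off_axes_cos_sin_nonzero[OF off(1)[rule_format, OF less(1)]]
      Suc.IH[OF off(2) less] Suc.IH[OF off(3) less]
    by (auto simp: Let_def)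
qed simp

text \<open>Since \<open>sgn\<close> is multiplicative, each of the \<open>n\<close> trigonometric factors of an entry is replaced by
  \<open>sqrt 2\<close> times its value at the bisector.\<close>

lemma sgn_butterfly_index:
  assumes "\<forall>j < num_angles a r n. off_axes (\<theta> $ j) \<and> \<theta>' $ j = quadrant_bisector (\<theta> $ j)"
    and "i < 2 ^ n" "j < 2 ^ n"
  shows "sgn (butterfly a r n \<theta> $$ (i, j)) = sqrt (2 ^ n) * butterfly a r n \<theta>' $$ (i, j)"
  using assms
proof (induction n arbitrary: \<theta> \<theta>' i j)
  case (Suc n)
  note inherits = row_angle_inherits left_angles_inherits right_angles_inherits
  note bis = inherits[where R = "\<lambda>t t'. off_axes t \<and> t' = quadrant_bisector t",
      OF Suc.prems(1)]
  define i' j' where "i' = (if i < 2 ^ n then i else i - 2 ^ n)"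
    and "j' = (if j < 2 ^ n then j else j - 2 ^ n)"
  have less: "i' < 2 ^ n" "j' < 2 ^ n"
    using Suc.prems(2,3) by (auto simp: i'_def j'_def)
  have "sgn (cos (row_angle a \<theta> i')) = sqrt 2 * cos (row_angle a \<theta>' i')"
    "sgn (sin (row_angle a \<theta> i')) = sqrt 2 * sin (row_angle a \<theta>' i')"
    using bis(1)[rule_format, OF less(1)] sgn_cos_sin_eq_bisector by auto
  then show ?case
    unfolding butterfly_Suc_index[OF Suc.prems(2,3)] i'_def[symmetric] j'_def[symmetric]
    using Suc.IH[OF bis(2) less] Suc.IH[OF bis(3) less]
    by (auto simp: Let_def sgn_mult sgn_minus real_sqrt_mult)
qed simp

section \<open>Sign matrices of butterfly matrices\<close>

theorem proposition6:
  fixes a :: angle_type and r :: recursion_type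
    and n N M :: nat and \<theta> \<theta>hat :: "real vec"
  assumes "n \<ge> 1"
    and "N = 2 ^ n"
    and "M = num_angles a r n"
    and "\<theta> \<in> carrier_vec M"
    and "\<forall>j<M. \<theta> $ j \<in> {0..<2 * pi}"
    and "\<forall>j<M. \<not> (\<exists>k::int. \<theta> $ j = pi / 2 * real_of_int k)"
    and "\<theta>hat \<in> carrier_vec M"
    and "\<forall>j<M. \<theta>hat $ j = pi / 4 * (2 * real_of_int \<lfloor>2 * \<theta> $ j / pi\<rfloor> + 1)"
  shows "map_mat sgn (butterfly a r n \<theta>) = sqrt (real N) \<cdot>\<^sub>m butterfly a r n \<theta>hat
    \<and> hadamard_mat N (map_mat sgn (butterfly a r n \<theta>))"
proof -
  let ?B = "butterfly a r n \<theta>" and ?B' = "butterfly a r n \<theta>hat"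
  have ang: "\<forall>j < num_angles a r n. off_axes (\<theta> $ j) \<and> \<theta>hat $ j = quadrant_bisector (\<theta> $ j)"
    using assms(3,6,8) by (simp add: off_axes_def quadrant_bisector_def)
  have B: "?B \<in> carrier_mat N N" and B': "?B' \<in> carrier_mat N N"
    using assms(2) by simp_all
  have eq: "map_mat sgn ?B = sqrt (real N) \<cdot>\<^sub>m ?B'"
  proof (rule eq_matI)
    fix i j
    assume "i < dim_row (sqrt (real N) \<cdot>\<^sub>m ?B')" "j < dim_col (sqrt (real N) \<cdot>\<^sub>m ?B')"
    then have "i < 2 ^ n" "j < 2 ^ n"
      using B' assms(2) by auto
    with sgn_butterfly_index[OF ang this]
    show "map_mat sgn ?B $$ (i, j) = (sqrt (real N) \<cdot>\<^sub>m ?B') $$ (i, j)"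
      using assms(2) by (simp add: carrier_matD[OF butterfly_carrier])
  qed (use B B' in auto)
  have "hadamard_mat N (map_mat sgn ?B)"
    unfolding hadamard_mat_def
  proof (intro conjI allI impI)
    show "map_mat sgn ?B \<in> carrier_mat N N"
      using B by simp
    fix i j assume ij: "i < N" "j < N"
    then have "?B $$ (i, j) \<noteq> 0"
      using butterfly_index_nonzero[of a r n \<theta> i j] ang assms(2) by simp
    then show "map_mat sgn ?B $$ (i, j) \<in> {1, - 1}"
      using B ij by (simp add: sgn_if)
  next
    have "(sqrt (real N) \<cdot>\<^sub>m ?B')\<^sup>T = sqrt (real N) \<cdot>\<^sub>m ?B'\<^sup>T"
      by (rule eq_matI) auto
    then have "map_mat sgn ?B * (map_mat sgn ?B)\<^sup>T =
        (sqrt (real N) \<cdot>\<^sub>m ?B') * (sqrt (real N) \<cdot>\<^sub>m ?B'\<^sup>T)"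
      unfolding eq by simp
    also have "\<dots> = real N \<cdot>\<^sub>m (?B' * ?B'\<^sup>T)"
      using B' by (intro eq_matI) auto
    also have "?B' * ?B'\<^sup>T = 1\<^sub>m N"
      using butterfly_orthogonal assms(2) by simp
    finally show "map_mat sgn ?B * (map_mat sgn ?B)\<^sup>T = real N \<cdot>\<^sub>m 1\<^sub>m N" .
  qed
  with eq show ?thesis
    by blast
qed

end
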